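(* Let $d\ge 1$, let $X=\{\bar x_1,\ldots,\bar x_n\}$ and $Y=\{\bar y_1,\ldots,\bar y_q\}$ be two spherical $M$-designs in the unit sphere $S^d\subset\mathbb{R}^{d+1}$, and let $\bar b>0$. Consider the $n$ spheres in $\mathbb{R}^{d+1}$ of curvature $\bar b$ centered at $\bar x_1,\ldots,\bar x_n$, and the $q$ spheres in $\mathbb{R}^{d+1}$ of curvature $\bar b$ centered at $\bar y_1,\ldots,\bar y_q$. Let $\Psi$ be a conformal transformation of $\mathbb{R}^{d+1}\cup\{\infty\}$ which sends each of these $n+q$ spheres to a sphere of finite radius. Let $x_i$ and $b_i$ be the center and the (signed) curvature of the image under $\Psi$ of the sphere centered at $\bar x_i$ ($i=1,\ldots,n$), and let $y_j$ and $c_j$ be the center and the (signed) curvature of the image under $\Psi$ of the sphere centered at $\bar y_j$ ($j=1,\ldots,q$). Then for every polynomial $F$ on $\mathbb{R}^{d+1}$ of degree not greater than $M$, $$\frac1n\sum_{i=1}^n F(b_i x_i)=\frac1q\sum_{j=1}^q F(c_j y_j).$$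
   Context: A finite collection of points $\{\bar x_1,\ldots,\bar x_n\}\subset S^d$, where $S^d\subset\mathbb{R}^{d+1}$ is the origin-centered unit sphere, is a spherical $M$-design if for every polynomial function on $\mathbb{R}^{d+1}$ of degree not greater than $M$ its average over $S^d$ (with respect to the standard rotation-invariant measure) equals its average $\frac1n\sum_i(\cdot)(\bar x_i)$ over the collection. Spheres in $\mathbb{R}^{d+1}$ are of codimension one. A coorientation of a sphere is a choice of one of the two components of its complement, thought of as a normal vector field pointing toward that component; a cooriented sphere of radius $r$ has signed curvature $1/r$ if the normal points inward and $-1/r$ if it points outward. The initial spheres have positive curvature $\bar b$ (radius $1/\bar b$, inward coorientation), and the image spheres carry the coorientation transported by $\Psi$. A conformal transformation of $\mathbb{R}^{d+1}\cup\{\infty\}$ means a Möbius transformation, possibly orientation reversing: a similarity or a composition of a similarity with an inversion in a unit sphere. *)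

theory Defs
  imports "HOL-Analysis.Analysis"
begin

section \<open>Polynomial functions of bounded degree\<close>

definition polynomial_of_degree_le :: "nat \<Rightarrow> (real^'n \<Rightarrow> real) \<Rightarrow> bool" where
  "polynomial_of_degree_le M F \<longleftrightarrow>
     (\<exists>a :: ('n \<Rightarrow> nat) \<Rightarrow> real. \<forall>x.
        F x = (\<Sum>\<alpha> | (\<Sum>i\<in>UNIV. \<alpha> i) \<le> M. a \<alpha> * (\<Prod>i\<in>UNIV. (x $ i) ^ \<alpha> i)))"

text \<open>The sum in the definition is a genuine one:\<close>

lemma finite_multi_indices:
  "finite {\<alpha> :: 'n::finite \<Rightarrow> nat. (\<Sum>i\<in>UNIV. \<alpha> i) \<le> M}"
proof (rule finite_subset)
  have "\<alpha> i \<le> M" if "(\<Sum>i\<in>UNIV. \<alpha> i) \<le> M" for \<alpha> :: "'n \<Rightarrow> nat" and i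
    using member_le_sum[of i UNIV \<alpha>] that by simp
  then show "{\<alpha> :: 'n \<Rightarrow> nat. (\<Sum>i\<in>UNIV. \<alpha> i) \<le> M} \<subseteq> UNIV \<rightarrow>\<^sub>E {..M}"
    by auto
  show "finite ((UNIV :: 'n set) \<rightarrow>\<^sub>E {..M})"
    by (intro finite_PiE) auto
qed


section \<open>The uniform probability measure on the unit sphere\<close>

text \<open>
  The normalised rotation-invariant measure on the unit sphere, realised as the radial projection
  of the uniform distribution on the unit ball and regarded as a Borel measure on the whole
  space. The origin, where \<open>sgn\<close> does not take values in the sphere, is a null set. It is proved
  below that the measure has total mass 1, is concentrated on the unit sphere and is invariant
  under orthogonal transformations, which determines it uniquely.
\<close>

definition sphere_measure :: "'a::euclidean_space measure" where
  "sphere_measure = distr (uniform_measure lborel (cball 0 1)) borel sgn"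

lemma borel_measurable_sgn_euclidean [measurable]:
  "(sgn :: 'a::euclidean_space \<Rightarrow> 'a) \<in> borel_measurable borel"
  unfolding sgn_div_norm by measurable

lemma space_sphere_measure [simp]: "space sphere_measure = UNIV"
  and sets_sphere_measure [measurable_cong, simp]: "sets sphere_measure = sets borel"
  by (simp_all add: sphere_measure_def)

lemma emeasure_lborel_unit_cball:
  "emeasure lborel (cball (0::'a::euclidean_space) 1) \<noteq> 0"
  "emeasure lborel (cball (0::'a::euclidean_space) 1) \<noteq> \<infinity>"
proof -
  have "0 < measure lborel (cball (0::'a) 1)"
    using content_cball_pos[of 1 "0::'a"] by simp
  then show "emeasure lborel (cball (0::'a) 1) \<noteq> 0"
    by (auto simp: measure_def)
  show "emeasure lborel (cball (0::'a) 1) \<noteq> \<infinity>"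
    using emeasure_lborel_cball_finite[of "0::'a" 1] by simp
qed


lemma emeasure_sphere_measure:
  fixes A :: "'a::euclidean_space set"
  assumes [measurable]: "A \<in> sets borel"
  shows "emeasure sphere_measure A =
    emeasure lborel (cball 0 1 \<inter> sgn -` A) / emeasure lborel (cball (0::'a) 1)"
proof -
  have "sgn -` A \<in> sets (borel :: 'a measure)"
    using measurable_sets[OF borel_measurable_sgn_euclidean assms] by simp
  then show ?thesis
    by (simp add: sphere_measure_def emeasure_distr)
qed

lemma emeasure_sphere_measure_UNIV:
  "emeasure sphere_measure (UNIV :: 'a::euclidean_space set) = 1"
  using emeasure_lborel_unit_cball[where 'a = 'a]
  by (simp add: emeasure_sphere_measure ennreal_divide_self top.not_eq_extremum)

lemma AE_sphere_measure: "AE x in sphere_measure. x \<in> sphere (0::'a::euclidean_space) 1"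
proof -
  have "AE x in lborel. x \<noteq> (0::'a)"
    by (rule AE_lborel_singleton)
  then have "AE x in uniform_measure lborel (cball (0::'a) 1). sgn x \<in> sphere 0 1"
    by (intro AE_uniform_measureI) (auto simp: norm_sgn)
  then show ?thesis
    unfolding sphere_measure_def by (subst AE_distr_iff) auto
qed

lemma nn_integral_lborel_translation:
  fixes g :: "'a::euclidean_space \<Rightarrow> ennreal"
  assumes [measurable]: "g \<in> borel_measurable borel"
  shows "(\<integral>\<^sup>+x. g (c + x) \<partial>lborel) = (\<integral>\<^sup>+x. g x \<partial>lborel)"
proof -
  have "(\<integral>\<^sup>+x. g x \<partial>lborel) = (\<integral>\<^sup>+x. g x \<partial>distr lborel borel ((+) c))"
    by (simp add: lborel_distr_plus)
  also have "\<dots> = (\<integral>\<^sup>+x. g (c + x) \<partial>lborel)"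
    by (rule nn_integral_distr) auto
  finally show ?thesis ..
qed

lemma emeasure_lborel_orthogonal_vimage:
  fixes f :: "'a::euclidean_space \<Rightarrow> 'a"
  assumes f: "orthogonal_transformation f" and [measurable]: "A \<in> sets borel"
  shows "emeasure lborel (f -` A) = emeasure lborel A"
proof -
  let ?B = "cball (0::'a) 1"
  have lin: "linear f" and surj: "surj f" and nrm: "norm (f x) = norm x" for x
    using f by (auto simp: orthogonal_transformation_linear orthogonal_transformation_surj
        orthogonal_transformation_norm)
  have [measurable]: "f \<in> borel_measurable borel"
    using lin by (intro borel_measurable_continuous_onI linear_continuous_on)
      (simp add: linear_conv_bounded_linear)
  have fA [measurable]: "f -` A \<in> sets borel"
    using measurable_sets[of f borel borel A] by simp
  have B [measurable]: "?B \<in> sets borel"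
    by simp
  have "emeasure lborel ?B * emeasure lborel (f -` A) =
      (\<integral>\<^sup>+x. indicator A (f x) * (\<integral>\<^sup>+y. indicator ?B y \<partial>lborel) \<partial>lborel)"
  proof -
    have "(\<integral>\<^sup>+x. indicator A (f x) \<partial>lborel) = (\<integral>\<^sup>+x. indicator (f -` A) x \<partial>lborel)"
      by (intro nn_integral_cong) (simp add: indicator_def)
    then show ?thesis by (simp add: nn_integral_multc mult.commute)
  qed
  also have "\<dots> = (\<integral>\<^sup>+x. indicator A (f x) * (\<integral>\<^sup>+y. indicator ?B (- f x + y) \<partial>lborel) \<partial>lborel)"
    by (simp only: nn_integral_lborel_translation[OF borel_measurable_indicator[OF B]])
  also have "\<dots> = (\<integral>\<^sup>+x. (\<integral>\<^sup>+y. indicator A (f x) * indicator ?B (- f x + y) \<partial>lborel) \<partial>lborel)"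
    by (simp add: nn_integral_cmult)
  also have "\<dots> = (\<integral>\<^sup>+y. (\<integral>\<^sup>+x. indicator A (f x) * indicator ?B (- f x + y) \<partial>lborel) \<partial>lborel)"
    by (rule lborel_pair.Fubini') measurable
  also have "\<dots> = (\<integral>\<^sup>+y. (\<integral>\<^sup>+x. indicator A (f x + y) * indicator ?B x \<partial>lborel) \<partial>lborel)"
  proof (rule nn_integral_cong)
    fix y :: 'a
    obtain z where z: "y = f z" using surj by (metis surjD)
    have "(\<integral>\<^sup>+x. indicator A (f x) * indicator ?B (- f x + y) \<partial>lborel) =
        (\<integral>\<^sup>+x. indicator A (f (z + x)) * indicator ?B (- f (z + x) + y) \<partial>lborel)"
      by (rule nn_integral_lborel_translation[symmetric]) measurable
    also have "\<dots> = (\<integral>\<^sup>+x. indicator A (f x + y) * indicator ?B x \<partial>lborel)"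
      by (intro nn_integral_cong)
        (simp add: z linear_add[OF lin] indicator_def nrm add.commute)
    finally show "(\<integral>\<^sup>+x. indicator A (f x) * indicator ?B (- f x + y) \<partial>lborel) =
        (\<integral>\<^sup>+x. indicator A (f x + y) * indicator ?B x \<partial>lborel)" .
  qed
  also have "\<dots> = (\<integral>\<^sup>+x. (\<integral>\<^sup>+y. indicator A (f x + y) * indicator ?B x \<partial>lborel) \<partial>lborel)"
    by (rule lborel_pair.Fubini') measurable
  also have "\<dots> = (\<integral>\<^sup>+x. (\<integral>\<^sup>+y. indicator A (f x + y) \<partial>lborel) * indicator ?B x \<partial>lborel)"
    by (simp add: nn_integral_multc)
  also have "\<dots> = (\<integral>\<^sup>+x. (\<integral>\<^sup>+y. indicator A y \<partial>lborel) * indicator ?B x \<partial>lborel)"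
    by (simp only: nn_integral_lborel_translation[OF borel_measurable_indicator[OF assms(2)]])
  also have "\<dots> = emeasure lborel ?B * emeasure lborel A"
    by (simp add: nn_integral_cmult mult.commute)
  finally show ?thesis
    using emeasure_lborel_unit_cball[where 'a = 'a]
    by (simp add: ennreal_mult_cancel_left)
qed

lemma sphere_measure_rotation_invariant:
  fixes f :: "'a::euclidean_space \<Rightarrow> 'a"
  assumes f: "orthogonal_transformation f"
  shows "distr sphere_measure borel f = sphere_measure"
proof (rule measure_eqI)
  have lin: "linear f" and nrm: "norm (f x) = norm x" for x
    using f by (auto simp: orthogonal_transformation_linear orthogonal_transformation_norm)
  have f_meas [measurable]: "f \<in> borel_measurable borel"
    using lin by (intro borel_measurable_continuous_onI linear_continuous_on)
      (simp add: linear_conv_bounded_linear)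
  show "emeasure (distr sphere_measure borel f) A = emeasure sphere_measure A"
    if "A \<in> sets (distr sphere_measure borel f)" for A
  proof -
    have A: "A \<in> sets borel" using that by simp
    have fA: "f -` A \<in> sets borel"
      using measurable_sets[OF f_meas A] by simp
    have T: "cball 0 1 \<inter> sgn -` A \<in> sets borel"
      using measurable_sets[OF borel_measurable_sgn_euclidean A] by simp
    have "sgn (f x) = f (sgn x)" for x
      using lin by (simp add: sgn_div_norm nrm linear_cmul)
    then have "f -` (cball 0 1 \<inter> sgn -` A) = cball 0 1 \<inter> sgn -` (f -` A)"
      by (auto simp: nrm)
    with emeasure_lborel_orthogonal_vimage[OF f T] show ?thesis
      using A fA by (simp add: emeasure_distr emeasure_sphere_measure)
  qed
qed simp


section \<open>Spherical designs\<close>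

text \<open>The points are \<open>x 0, \<dots>, x (n - 1)\<close>; repetitions are allowed.\<close>

definition spherical_design :: "nat \<Rightarrow> nat \<Rightarrow> (nat \<Rightarrow> real^'n) \<Rightarrow> bool" where
  "spherical_design M n x \<longleftrightarrow>
     n > 0 \<and> (\<forall>i<n. x i \<in> sphere 0 1) \<and>
     (\<forall>F. polynomial_of_degree_le M F \<longrightarrow>
        (\<integral>z. F z \<partial>sphere_measure) = (1 / real n) * (\<Sum>i<n. F (x i)))"


section \<open>Conformal transformations\<close>

text \<open>The point \<open>\<infinity>\<close> of the extended space is \<open>None\<close>.\<close>

definition similarity :: "('a::euclidean_space \<Rightarrow> 'a) \<Rightarrow> bool" where
  "similarity f \<longleftrightarrow> (\<exists>k>0. \<forall>x y. dist (f x) (f y) = k * dist x y)"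

definition unit_inversion :: "'a::euclidean_space \<Rightarrow> 'a option \<Rightarrow> 'a option" where
  "unit_inversion a p =
     (case p of
        None \<Rightarrow> Some a
      | Some x \<Rightarrow> if x = a then None else Some (a + (x - a) /\<^sub>R (norm (x - a))\<^sup>2))"

definition conformal_transformation :: "('a::euclidean_space option \<Rightarrow> 'a option) \<Rightarrow> bool" where
  "conformal_transformation \<Psi> \<longleftrightarrow>
     (\<exists>f. similarity f \<and> (\<Psi> = map_option f \<or> (\<exists>a. \<Psi> = map_option f \<circ> unit_inversion a)))"


section \<open>Cooriented spheres\<close>

text \<open>
  A cooriented sphere is a pair consisting of a sphere and of the component of its complement in
  the extended space towards which the normal points. \<open>cooriented_sphere c b\<close> is the
  one with centre \<open>c\<close> and signed curvature \<open>b \<noteq> 0\<close>: its radius is \<open>1 / \<bar>b\<bar>\<close>, and the chosen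
  component is the open ball if \<open>b > 0\<close> and the exterior, which contains \<open>\<infinity>\<close>, if \<open>b < 0\<close>.
  Mapping both entries by a conformal transformation transports the coorientation.
\<close>

definition cooriented_sphere ::
    "'a::euclidean_space \<Rightarrow> real \<Rightarrow> 'a option set \<times> 'a option set" where
  "cooriented_sphere c b =
     (Some ` sphere c (1 / \<bar>b\<bar>),
      if b > 0 then Some ` ball c (1 / \<bar>b\<bar>) else - (Some ` cball c (1 / \<bar>b\<bar>)))"

definition transport ::
    "('a option \<Rightarrow> 'a option) \<Rightarrow> 'a option set \<times> 'a option set \<Rightarrow> 'a option set \<times> 'a option set" where
  "transport \<Psi> = map_prod (image \<Psi>) (image \<Psi>)"

lemma cooriented_sphere_eq_iff:
  fixes c c' :: "'a::euclidean_space"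
  assumes "b \<noteq> 0" "b' \<noteq> 0"
  shows "cooriented_sphere c b = cooriented_sphere c' b' \<longleftrightarrow> c = c' \<and> b = b'"
proof
  assume eq: "cooriented_sphere c b = cooriented_sphere c' b'"
  have mem: "None \<in> snd (cooriented_sphere c b) \<longleftrightarrow> b \<le> 0" for c :: 'a and b
    by (auto simp: cooriented_sphere_def)
  have sgn: "b > 0 \<longleftrightarrow> b' > 0"
    using mem[of c b] mem[of c' b'] eq by auto
  have "cball c (1 / \<bar>b\<bar>) = cball c' (1 / \<bar>b'\<bar>)"
  proof (cases "b > 0")
    case True
    then have "ball c (1 / \<bar>b\<bar>) = ball c' (1 / \<bar>b'\<bar>)"
      using eq sgn by (auto simp: cooriented_sphere_def inj_image_eq_iff)
    then show ?thesis
      using assms by (metis closure_ball zero_less_abs_iff zero_less_divide_1_iff)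
  next
    case False
    then show ?thesis
      using eq sgn by (auto simp: cooriented_sphere_def inj_image_eq_iff)
  qed
  then show "c = c' \<and> b = b'"
    using assms sgn by (auto simp: cball_eq_cball_iff abs_if divide_simps split: if_splits)
qed simp

end

theory Submission
  imports Defs
begin

text \<open>
  For spheres of one fixed curvature with centre \<open>z\<close> on the unit sphere, the signed curvature of the
  image times its centre is an affine function of \<open>z\<close>.

  The reason is visible for the inversion at \<open>a\<close>. If \<open>a\<close> does not lie on the sphere with centre
  \<open>z\<close> and signed curvature \<open>b\<close>, then this sphere is mapped to the one with centre
  \<open>a + (z - a) /\<^sub>R D\<close> and signed curvature \<open>b * D\<close>, where
  \<open>D = (norm (z - a))\<^sup>2 - (1 / b)\<^sup>2\<close> is the power of \<open>a\<close> with respect to the sphere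
  (\<open>transport_unit_inversion\<close>). In the product \<open>b *\<^sub>R (D *\<^sub>R a + (z - a))\<close> the denominator
  cancels. The only nonlinear part of \<open>D\<close> is \<open>(norm z)\<^sup>2\<close>, which is 1 on the unit sphere. A similarity
  with ratio \<open>k\<close> applied afterwards divides the curvature by \<open>k\<close>, and its translation part adds a
  constant multiple of \<open>D\<close> to the product, which is affine again
  (\<open>curvature_times_centre_affine\<close>).

  The affine map depends only on \<open>\<Psi>\<close> and on the common curvature, not on the design. Composing
  \<open>F\<close> with it gives one polynomial of degree at most \<open>M\<close> (\<open>polynomial_of_degree_le_affine\<close>),
  and both averages in the theorem are equal to the mean of this polynomial over the unit sphere
  (\<open>design_average_of_affine_image\<close>).
\<close>

section \<open>Polynomials of bounded degree under affine substitution\<close>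

lemma polynomial_of_degree_le_add:
  assumes "polynomial_of_degree_le M F" "polynomial_of_degree_le M G"
  shows "polynomial_of_degree_le M (\<lambda>x. F x + G x)"
proof -
  from assms obtain a a' where
    "\<And>x. F x = (\<Sum>\<alpha> | (\<Sum>i\<in>UNIV. \<alpha> i) \<le> M. a \<alpha> * (\<Prod>i\<in>UNIV. (x $ i) ^ \<alpha> i))"
    "\<And>x. G x = (\<Sum>\<alpha> | (\<Sum>i\<in>UNIV. \<alpha> i) \<le> M. a' \<alpha> * (\<Prod>i\<in>UNIV. (x $ i) ^ \<alpha> i))"
    unfolding polynomial_of_degree_le_def by blast
  then show ?thesis
    unfolding polynomial_of_degree_le_def
    by (intro exI[of _ "\<lambda>\<alpha>. a \<alpha> + a' \<alpha>"]) (simp add: distrib_right sum.distrib)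
qed

lemma polynomial_of_degree_le_monomial:
  fixes \<alpha> :: "'n::finite \<Rightarrow> nat"
  assumes "(\<Sum>i\<in>UNIV. \<alpha> i) \<le> M"
  shows "polynomial_of_degree_le M (\<lambda>x. r * (\<Prod>i\<in>UNIV. (x $ i) ^ \<alpha> i))"
  unfolding polynomial_of_degree_le_def
proof (intro exI[of _ "\<lambda>\<beta>. if \<beta> = \<alpha> then r else 0"] allI)
  fix x :: "real^'n"
  show "r * (\<Prod>i\<in>UNIV. (x $ i) ^ \<alpha> i) =
      (\<Sum>\<beta> | (\<Sum>i\<in>UNIV. \<beta> i) \<le> M. (if \<beta> = \<alpha> then r else 0) * (\<Prod>i\<in>UNIV. (x $ i) ^ \<beta> i))"
    using assms by (simp add: finite_multi_indices if_distrib[of "\<lambda>t. t * _"] cong: if_cong)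
qed

lemma polynomial_of_degree_le_const: "polynomial_of_degree_le M (\<lambda>x :: real^'n::finite. r)"
  using polynomial_of_degree_le_monomial[of "\<lambda>_ :: 'n. 0" M r] by simp

lemma polynomial_of_degree_le_sum:
  assumes "\<And>s. s \<in> S \<Longrightarrow> polynomial_of_degree_le M (F s)"
  shows "polynomial_of_degree_le M (\<lambda>x. \<Sum>s\<in>S. F s x)"
  using assms
  by (induction S rule: infinite_finite_induct)
    (simp_all add: polynomial_of_degree_le_const polynomial_of_degree_le_add)

lemma polynomial_of_degree_le_mult:
  fixes F G :: "real^'n::finite \<Rightarrow> real"
  assumes "polynomial_of_degree_le M F" "polynomial_of_degree_le N G"
  shows "polynomial_of_degree_le (M + N) (\<lambda>x. F x * G x)"
proof -
  from assms obtain a a' where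
    F: "\<And>x. F x = (\<Sum>\<alpha> | (\<Sum>i\<in>UNIV. \<alpha> i) \<le> M. a \<alpha> * (\<Prod>i\<in>UNIV. (x $ i) ^ \<alpha> i))" and
    G: "\<And>x. G x = (\<Sum>\<beta> | (\<Sum>i\<in>UNIV. \<beta> i) \<le> N. a' \<beta> * (\<Prod>i\<in>UNIV. (x $ i) ^ \<beta> i))"
    unfolding polynomial_of_degree_le_def by blast
  have "F x * G x = (\<Sum>\<alpha> | (\<Sum>i\<in>UNIV. \<alpha> i) \<le> M. \<Sum>\<beta> | (\<Sum>i\<in>UNIV. \<beta> i) \<le> N.
      (a \<alpha> * a' \<beta>) * (\<Prod>i\<in>UNIV. (x $ i) ^ (\<alpha> i + \<beta> i)))" for x
    unfolding F G sum_product
    by (intro sum.cong refl) (simp add: power_add prod.distrib)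
  moreover have "polynomial_of_degree_le (M + N) (\<lambda>x. \<Sum>\<alpha> | (\<Sum>i\<in>UNIV. \<alpha> i) \<le> M.
      \<Sum>\<beta> | (\<Sum>i\<in>UNIV. \<beta> i) \<le> N. (a \<alpha> * a' \<beta>) * (\<Prod>i\<in>UNIV. (x $ i) ^ (\<alpha> i + \<beta> i)))"
    by (intro polynomial_of_degree_le_sum polynomial_of_degree_le_monomial)
      (auto simp: sum.distrib intro: add_mono)
  ultimately show ?thesis by simp
qed

lemma polynomial_of_degree_le_power:
  assumes "polynomial_of_degree_le M F"
  shows "polynomial_of_degree_le (k * M) (\<lambda>x. F x ^ k)"
  by (induction k) (auto intro: polynomial_of_degree_le_const polynomial_of_degree_le_mult assms)

lemma polynomial_of_degree_le_prod:
  assumes "\<And>s. s \<in> S \<Longrightarrow> polynomial_of_degree_le (M s) (F s)"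
  shows "polynomial_of_degree_le (\<Sum>s\<in>S. M s) (\<lambda>x. \<Prod>s\<in>S. F s x)"
  using assms
  by (induction S rule: infinite_finite_induct)
    (simp_all add: polynomial_of_degree_le_const polynomial_of_degree_le_mult)

lemma polynomial_of_degree_le_mono:
  fixes F :: "real^'n::finite \<Rightarrow> real"
  assumes "polynomial_of_degree_le M F" "M \<le> N"
  shows "polynomial_of_degree_le N F"
  using polynomial_of_degree_le_mult[OF assms(1) polynomial_of_degree_le_const[of "N - M" 1]]
    assms(2) by simp

lemma polynomial_of_degree_le_linear:
  fixes g :: "real^'n::finite \<Rightarrow> real"
  assumes "linear g"
  shows "polynomial_of_degree_le 1 g"
proof -
  have expansion: "g = (\<lambda>x. \<Sum>j\<in>UNIV. g (axis j 1) * x $ j)"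
  proof
    fix x
    have "g x = g (\<Sum>j\<in>UNIV. (x $ j) *\<^sub>R axis j 1)"
      by (simp add: basis_expansion flip: scalar_mult_eq_scaleR)
    then show "g x = (\<Sum>j\<in>UNIV. g (axis j 1) * x $ j)"
      by (simp add: linear_sum[OF assms] linear_cmul[OF assms] mult.commute)
  qed
  have coordinate: "polynomial_of_degree_le 1 (\<lambda>x :: real^'n. r * x $ j)" for r j
  proof -
    have "(\<Prod>i\<in>UNIV. (x $ i) ^ (if i = j then 1 else 0)) = x $ j" for x :: "real^'n"
      by (simp add: if_distrib[of "\<lambda>m. _ ^ m"] cong: if_cong)
    then show ?thesis
      using polynomial_of_degree_le_monomial[of "\<lambda>i. if i = j then 1 else 0" 1 r] by simp
  qed
  show ?thesis
    by (subst expansion) (intro polynomial_of_degree_le_sum coordinate)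
qed

text \<open>
  Each coordinate of \<open>e + L z\<close> has degree at most 1 in \<open>z\<close>, so the substitution turns a monomial
  with exponents \<open>\<alpha>\<close> into a product of \<open>\<Sum>i\<in>UNIV. \<alpha> i\<close> such factors.
\<close>

lemma polynomial_of_degree_le_affine:
  fixes F :: "real^'n::finite \<Rightarrow> real" and L :: "real^'m::finite \<Rightarrow> real^'n"
  assumes F: "polynomial_of_degree_le M F" and L: "linear L"
  shows "polynomial_of_degree_le M (\<lambda>z. F (e + L z))"
proof -
  obtain a where
    a: "\<And>x. F x = (\<Sum>\<alpha> | (\<Sum>i\<in>UNIV. \<alpha> i) \<le> M. a \<alpha> * (\<Prod>i\<in>UNIV. (x $ i) ^ \<alpha> i))"
    using F unfolding polynomial_of_degree_le_def by blast
  have coord: "polynomial_of_degree_le 1 (\<lambda>z. (e + L z) $ i)" for i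
  proof -
    have "linear (\<lambda>z. L z $ i)"
      using linear_compose[OF L, of "\<lambda>x. x $ i"]
      by (simp add: o_def linear_iff)
    then have "polynomial_of_degree_le 1 (\<lambda>z. e $ i + L z $ i)"
      by (intro polynomial_of_degree_le_add polynomial_of_degree_le_const
          polynomial_of_degree_le_linear)
    then show ?thesis by simp
  qed
  have "polynomial_of_degree_le M (\<lambda>z. a \<alpha> * (\<Prod>i\<in>UNIV. ((e + L z) $ i) ^ \<alpha> i))"
    if "(\<Sum>i\<in>UNIV. \<alpha> i) \<le> M" for \<alpha>
  proof -
    have "polynomial_of_degree_le (\<Sum>i\<in>UNIV. \<alpha> i * 1) (\<lambda>z. \<Prod>i\<in>UNIV. ((e + L z) $ i) ^ \<alpha> i)"
      by (intro polynomial_of_degree_le_prod polynomial_of_degree_le_power coord)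
    then have "polynomial_of_degree_le (0 + (\<Sum>i\<in>UNIV. \<alpha> i * 1))
        (\<lambda>z. a \<alpha> * (\<Prod>i\<in>UNIV. ((e + L z) $ i) ^ \<alpha> i))"
      by (intro polynomial_of_degree_le_mult polynomial_of_degree_le_const)
    then show ?thesis
      by (rule polynomial_of_degree_le_mono) (use that in simp)
  qed
  then show ?thesis
    unfolding a by (intro polynomial_of_degree_le_sum) simp
qed

section \<open>Cooriented spheres under similarities and inversions\<close>

lemma similarity_decomposition:
  assumes "similarity f"
  obtains k U where "k > 0" "orthogonal_transformation U" "\<And>x. f x = f 0 + k *\<^sub>R U x"
proof -
  obtain k where k: "k > 0" "\<And>x y. dist (f x) (f y) = k * dist x y"
    using assms unfolding similarity_def by blast
  let ?U = "\<lambda>x. (f x - f 0) /\<^sub>R k"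
  have "dist (?U x) (?U y) = dist x y" for x y
  proof -
    have "?U x - ?U y = (f x - f y) /\<^sub>R k"
      by (simp add: algebra_simps)
    then show ?thesis
      using k by (simp add: dist_norm)
  qed
  then have "orthogonal_transformation ?U"
    by (simp add: orthogonal_transformation_isometry)
  with k(1) show thesis by (intro that[of k ?U]) auto
qed

text \<open>
  The power \<open>(norm (p - c))\<^sup>2 - (1 / b)\<^sup>2\<close> of a point \<open>p\<close> is negative exactly inside the sphere.
  Multiplied by \<open>b\<close>, it is negative exactly on the chosen component, for both signs of \<open>b\<close>. Hence
  it suffices below to follow the power under a transformation.
\<close>

lemma cooriented_sphere_membership:
  assumes "b \<noteq> 0"
  shows "Some p \<in> fst (cooriented_sphere c b) \<longleftrightarrow> (norm (p - c))\<^sup>2 - (1 / b)\<^sup>2 = 0"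
    and "Some p \<in> snd (cooriented_sphere c b) \<longleftrightarrow> b * ((norm (p - c))\<^sup>2 - (1 / b)\<^sup>2) < 0"
    and "None \<notin> fst (cooriented_sphere c b)"
    and "None \<in> snd (cooriented_sphere c b) \<longleftrightarrow> b < 0"
proof -
  have sq: "(1 / b)\<^sup>2 = (1 / \<bar>b\<bar>)\<^sup>2" by (simp add: power_divide)
  have eq: "(norm (p - c))\<^sup>2 = (1 / b)\<^sup>2 \<longleftrightarrow> dist c p = 1 / \<bar>b\<bar>"
    unfolding sq by (subst power2_eq_iff_nonneg) (auto simp: dist_norm norm_minus_commute)
  have less: "(norm (p - c))\<^sup>2 < (1 / b)\<^sup>2 \<longleftrightarrow> dist c p < 1 / \<bar>b\<bar>"
    unfolding sq
    using power_mono_iff[of "1 / \<bar>b\<bar>" "dist c p" 2]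
    by (auto simp: dist_norm norm_minus_commute not_le[symmetric] simp del: not_le)
  show "Some p \<in> fst (cooriented_sphere c b) \<longleftrightarrow> (norm (p - c))\<^sup>2 - (1 / b)\<^sup>2 = 0"
    using eq by (auto simp: cooriented_sphere_def)
  show "Some p \<in> snd (cooriented_sphere c b) \<longleftrightarrow> b * ((norm (p - c))\<^sup>2 - (1 / b)\<^sup>2) < 0"
    using eq less assms
    by (cases "b > 0") (auto simp: cooriented_sphere_def mult_less_0_iff)
  show "None \<notin> fst (cooriented_sphere c b)" "None \<in> snd (cooriented_sphere c b) \<longleftrightarrow> b < 0"
    using assms by (auto simp: cooriented_sphere_def)
qed

lemma transport_eqI:
  assumes "surj \<Psi>" and "\<And>p. \<Psi> p \<in> fst T \<longleftrightarrow> p \<in> fst S" and "\<And>p. \<Psi> p \<in> snd T \<longleftrightarrow> p \<in> snd S"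
  shows "transport \<Psi> S = T"
proof -
  have "fst S = \<Psi> -` fst T" "snd S = \<Psi> -` snd T"
    using assms by auto
  then show ?thesis
    using assms(1) by (intro prod_eqI) (simp_all add: transport_def surj_image_vimage_eq)
qed

text \<open>
  The similarity multiplies powers by \<open>k\<^sup>2\<close>, and the factor is positive, so that the sphere and the
  chosen component are both respected.
\<close>

lemma transport_similarity:
  fixes f :: "'a::euclidean_space \<Rightarrow> 'a"
  assumes k: "k > 0" and U: "orthogonal_transformation U" and f: "\<And>x. f x = t + k *\<^sub>R U x"
    and b: "b \<noteq> 0"
  shows "transport (map_option f) (cooriented_sphere z b) = cooriented_sphere (f z) (b / k)"
proof (rule transport_eqI)
  have bk: "b / k \<noteq> 0" using b k by simp
  have power: "(norm (f x - f z))\<^sup>2 - (1 / (b / k))\<^sup>2 = k\<^sup>2 * ((norm (x - z))\<^sup>2 - (1 / b)\<^sup>2)" for x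
  proof -
    have "f x - f z = k *\<^sub>R U (x - z)"
      by (simp add: f linear_diff[OF orthogonal_transformation_linear[OF U]] scaleR_diff_right)
    then have "norm (f x - f z) = k * norm (x - z)"
      using k orthogonal_transformation_norm[OF U] by simp
    then show ?thesis
      by (simp add: power_mult_distrib power_divide right_diff_distrib)
  qed
  have sign: "b / k * (k\<^sup>2 * P) < 0 \<longleftrightarrow> b * P < 0" for P
  proof -
    have "b / k * (k\<^sup>2 * P) = k * (b * P)"
      using k by (simp add: power2_eq_square)
    then show ?thesis using k by (simp add: mult_less_0_iff)
  qed
  show "map_option f p \<in> fst (cooriented_sphere (f z) (b / k)) \<longleftrightarrow>
      p \<in> fst (cooriented_sphere z b)" for p
    using k by (cases p) (simp_all only: option.map cooriented_sphere_membership[OF b]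
        cooriented_sphere_membership[OF bk] power, simp)
  show "map_option f p \<in> snd (cooriented_sphere (f z) (b / k)) \<longleftrightarrow>
      p \<in> snd (cooriented_sphere z b)" for p
    using k by (cases p) (simp_all only: option.map cooriented_sphere_membership[OF b]
        cooriented_sphere_membership[OF bk] power sign, simp add: divide_less_0_iff)
  have surj_f: "\<exists>x. y = f x" for y
  proof -
    obtain x where "(y - t) /\<^sub>R k = U x"
      using orthogonal_transformation_surj[OF U] by (rule surjE)
    then have "y = f x" using k by (simp add: f flip: \<open>_ = U x\<close>)
    then show ?thesis ..
  qed
  have "y \<in> range (map_option f)" for y
  proof (cases y)
    case None
    then show ?thesis by (intro range_eqI[of _ _ None]) simp
  next
    case (Some y')
    with surj_f[of y'] obtain x where "y = map_option f (Some x)" by auto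
    then show ?thesis by (rule range_eqI)
  qed
  then show "surj (map_option f)" by blast
qed

lemma unit_inversion_involution: "unit_inversion a (unit_inversion a p) = p"
proof (cases p)
  case (Some x)
  have "(u /\<^sub>R (norm u)\<^sup>2) /\<^sub>R (norm (u /\<^sub>R (norm u)\<^sup>2))\<^sup>2 = u" if "u \<noteq> 0" for u :: 'a
  proof -
    have "norm (u /\<^sub>R (norm u)\<^sup>2) = inverse (norm u)"
      using that by (simp add: power2_eq_square)
    then show ?thesis using that by (simp add: power_inverse)
  qed
  from this[of "x - a"] Some show ?thesis
    by (cases "x = a") (simp_all add: unit_inversion_def)
qed (simp add: unit_inversion_def)

text \<open>
  For \<open>w \<noteq> 0\<close> the power of \<open>a + w\<close> with respect to the given sphere is \<open>(norm w)\<^sup>2 * D\<close> times the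
  power of its image with respect to the image sphere. The sign of \<open>D\<close>, negative when \<open>a\<close> is inside,
  is absorbed by the curvature \<open>b * D\<close>, so the chosen component is transported correctly in either
  case. The points \<open>Some a\<close> and \<open>None\<close>, which the inversion exchanges, are not covered by this
  identity.
\<close>

lemma transport_unit_inversion:
  fixes z a :: "'a::euclidean_space"
  assumes b: "b \<noteq> 0" and D: "D = (norm (z - a))\<^sup>2 - (1 / b)\<^sup>2" "D \<noteq> 0"
  shows "transport (unit_inversion a) (cooriented_sphere z b) =
    cooriented_sphere (a + (z - a) /\<^sub>R D) (b * D)"
proof -
  let ?S = "cooriented_sphere z b" and ?T = "cooriented_sphere (a + (z - a) /\<^sub>R D) (b * D)"
  have bD: "b * D \<noteq> 0" using b D by simp
  have power: "(norm (a + w /\<^sub>R (norm w)\<^sup>2 - (a + (z - a) /\<^sub>R D)))\<^sup>2 - (1 / (b * D))\<^sup>2 =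
      ((norm (a + w - z))\<^sup>2 - (1 / b)\<^sup>2) / ((norm w)\<^sup>2 * D)" if "w \<noteq> 0" for w
  proof -
    define m where "m = z - a"
    define W where "W = (norm w)\<^sup>2"
    have W: "W \<noteq> 0" "w \<bullet> w = W" using that by (simp_all add: W_def dot_square_norm)
    have radius_old: "(1 / b)\<^sup>2 = m \<bullet> m - D" by (simp add: D m_def dot_square_norm)
    have diffs: "a + w /\<^sub>R W - (a + m /\<^sub>R D) = w /\<^sub>R W - m /\<^sub>R D" "a + w - z = w - m"
      by (simp_all add: m_def)
    have norm_new: "(norm (w /\<^sub>R W - m /\<^sub>R D))\<^sup>2 = 1 / W - 2 * (w \<bullet> m) / (W * D) + (m \<bullet> m) / D\<^sup>2"
    proof -
      have "(norm (w /\<^sub>R W - m /\<^sub>R D))\<^sup>2 = (w \<bullet> w) / W\<^sup>2 - 2 * (w \<bullet> m) / (W * D) + (m \<bullet> m) / D\<^sup>2"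
        unfolding power2_norm_eq_inner
        by (simp add: inner_diff_left inner_diff_right inner_commute[of m w] divide_inverse
            power2_eq_square algebra_simps)
      then show ?thesis using W by (simp add: power2_eq_square)
    qed
    have norm_old: "(norm (w - m))\<^sup>2 = W - 2 * (w \<bullet> m) + m \<bullet> m"
      using W by (simp add: power2_norm_eq_inner inner_diff_left inner_diff_right
          inner_commute[of m w])
    have radius_new: "(1 / (b * D))\<^sup>2 = (m \<bullet> m - D) / D\<^sup>2"
      by (simp add: power_mult_distrib power_divide flip: radius_old)
    show ?thesis
      unfolding m_def[symmetric] W_def[symmetric] diffs norm_new norm_old radius_new radius_old
      using W D(2) by (simp add: field_simps power2_eq_square)
  qed
  have at_a: "(norm (a - (a + (z - a) /\<^sub>R D)))\<^sup>2 - (1 / (b * D))\<^sup>2 = 1 / D"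
  proof -
    have "(norm (a - (a + (z - a) /\<^sub>R D)))\<^sup>2 = (norm (z - a))\<^sup>2 / D\<^sup>2"
      by (simp add: power_divide power_mult_distrib power_inverse divide_inverse mult.commute)
    moreover have "(1 / (b * D))\<^sup>2 = ((norm (z - a))\<^sup>2 - D) / D\<^sup>2"
      using D(1) by (simp add: power_mult_distrib power_divide)
    ultimately show ?thesis
      using D(2) by (simp add: diff_divide_distrib power2_eq_square)
  qed
  have mem: "(unit_inversion a p \<in> fst ?T \<longleftrightarrow> p \<in> fst ?S) \<and>
      (unit_inversion a p \<in> snd ?T \<longleftrightarrow> p \<in> snd ?S)" for p
  proof (cases p)
    case None
    then have "unit_inversion a p = Some a" by (simp add: unit_inversion_def)
    then show ?thesis
      using b D(2) by (simp only: None cooriented_sphere_membership[OF b]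
          cooriented_sphere_membership[OF bD] at_a) simp
  next
    case (Some x)
    show ?thesis
    proof (cases "x = a")
      case True
      then show ?thesis
        using b bD D Some
        by (simp add: unit_inversion_def cooriented_sphere_membership norm_minus_commute)
    next
      case False
      have "b * D * (P / ((norm (x - a))\<^sup>2 * D)) < 0 \<longleftrightarrow> b * P < 0" for P
      proof -
        have "b * D * (P / ((norm (x - a))\<^sup>2 * D)) = b * P / (norm (x - a))\<^sup>2"
          using D(2) by simp
        then show ?thesis using False by (simp add: divide_less_0_iff mult_less_0_iff)
      qed
      then show ?thesis
        using b bD D(2) Some False power[of "x - a"]
        by (simp add: unit_inversion_def cooriented_sphere_membership)
    qed
  qed
  have "surj (unit_inversion a)"
    by (rule surjI) (rule unit_inversion_involution)
  then show ?thesis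
    by (rule transport_eqI) (use mem in blast)+
qed

text \<open>
  A finite image sphere forces \<open>D \<noteq> 0\<close>, since the inversion sends its own centre to \<open>None\<close>.
  The coefficients of the affine map come from
  \<open>D = 1 + (norm a)\<^sup>2 - (1 / b)\<^sup>2 - 2 * (a \<bullet> z)\<close>, which uses \<open>norm z = 1\<close>.
\<close>

lemma curvature_times_centre_affine:
  fixes \<Psi> :: "'a::euclidean_space option \<Rightarrow> 'a option"
  assumes \<Psi>: "conformal_transformation \<Psi>" and b: "b \<noteq> 0"
  obtains L e where "linear L"
    "\<forall>z p \<beta>. norm z = 1 \<longrightarrow> \<beta> \<noteq> 0 \<longrightarrow>
      transport \<Psi> (cooriented_sphere z b) = cooriented_sphere p \<beta> \<longrightarrow> \<beta> *\<^sub>R p = e + L z"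
proof -
  obtain f where f: "similarity f"
    and cases: "\<Psi> = map_option f \<or> (\<exists>a. \<Psi> = map_option f \<circ> unit_inversion a)"
    using \<Psi> unfolding conformal_transformation_def by blast
  obtain k U where k: "k > 0" and U: "orthogonal_transformation U"
    and fU: "\<And>x. f x = f 0 + k *\<^sub>R U x"
    using similarity_decomposition[OF f] by blast
  have lin: "linear U" using U by (rule orthogonal_transformation_linear)
  note transport_f = transport_similarity[OF k U fU]
  from cases show thesis
  proof (elim disjE exE)
    assume \<Psi>: "\<Psi> = map_option f"
    show thesis
    proof (rule that[of "\<lambda>z. b *\<^sub>R U z" "(b / k) *\<^sub>R f 0"]; (intro allI impI)?)
      show "linear (\<lambda>z. b *\<^sub>R U z)"
        using lin by (rule linear_compose_scale_right)
      fix z p \<beta>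
      assume "\<beta> \<noteq> 0" "transport \<Psi> (cooriented_sphere z b) = cooriented_sphere p \<beta>"
      then have "p = f z" "\<beta> = b / k"
        using cooriented_sphere_eq_iff[of "b / k" \<beta> "f z" p] b k by (auto simp: \<Psi> transport_f[OF b])
      then show "\<beta> *\<^sub>R p = (b / k) *\<^sub>R f 0 + b *\<^sub>R U z"
        using k by (simp add: fU[of z] scaleR_right_distrib)
    qed
  next
    fix a assume \<Psi>: "\<Psi> = map_option f \<circ> unit_inversion a"
    \<comment> \<open>With the power \<open>D = D0 - 2 * (a \<bullet> z)\<close>, the product of curvature and centre will be
      \<open>D *\<^sub>R v + b *\<^sub>R (U z - U a)\<close>.\<close>
    define D0 where "D0 = 1 + (norm a)\<^sup>2 - (1 / b)\<^sup>2"
    define v where "v = (b / k) *\<^sub>R f 0 + b *\<^sub>R U a"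
    show thesis
    proof (rule that[of "\<lambda>z. b *\<^sub>R U z - (2 * (a \<bullet> z)) *\<^sub>R v" "D0 *\<^sub>R v - b *\<^sub>R U a"]; (intro allI impI)?)
      show "linear (\<lambda>z. b *\<^sub>R U z - (2 * (a \<bullet> z)) *\<^sub>R v)"
        by (rule linearI)
          (simp_all add: linear_add[OF lin] linear_cmul[OF lin] inner_add_right algebra_simps)
      fix z p \<beta>
      assume z: "norm z = 1" and \<beta>: "\<beta> \<noteq> 0"
        and eq: "transport \<Psi> (cooriented_sphere z b) = cooriented_sphere p \<beta>"
      define D where "D = (norm (z - a))\<^sup>2 - (1 / b)\<^sup>2"
      have "D \<noteq> 0"
      proof
        assume "D = 0"
        then have "Some a \<in> fst (cooriented_sphere z b)"
          using b by (simp add: cooriented_sphere_membership D_def norm_minus_commute)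
        then have "\<Psi> (Some a) \<in> fst (transport \<Psi> (cooriented_sphere z b))"
          by (simp add: transport_def)
        moreover have "\<Psi> (Some a) = None"
          by (simp add: \<Psi> unit_inversion_def)
        ultimately show False
          using \<beta> by (simp add: eq cooriented_sphere_membership)
      qed
      then have "transport (unit_inversion a) (cooriented_sphere z b) =
          cooriented_sphere (a + (z - a) /\<^sub>R D) (b * D)"
        using D_def by (intro transport_unit_inversion[OF b])
      moreover have "transport \<Psi> S = transport (map_option f) (transport (unit_inversion a) S)" for S
        by (simp add: \<Psi> transport_def image_comp prod.map_comp map_prod_def split: prod.split)
      ultimately have "cooriented_sphere p \<beta> =
          cooriented_sphere (f (a + (z - a) /\<^sub>R D)) (b * D / k)"
        using eq b \<open>D \<noteq> 0\<close> by (simp add: transport_f)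
      then have p: "p = f (a + (z - a) /\<^sub>R D)" and \<beta>_eq: "\<beta> = b * D / k"
        using cooriented_sphere_eq_iff[of \<beta> "b * D / k"] \<beta> b k \<open>D \<noteq> 0\<close> by auto
      have "p = f 0 + k *\<^sub>R (U a + (U z - U a) /\<^sub>R D)"
        unfolding p by (subst fU)
          (simp add: linear_add[OF lin] linear_cmul[OF lin] linear_diff[OF lin])
      then have "\<beta> *\<^sub>R p = D *\<^sub>R v + b *\<^sub>R (U z - U a)"
        using k \<open>D \<noteq> 0\<close>
        by (simp add: \<beta>_eq v_def scaleR_right_distrib mult.commute[of D])
      moreover have "D = D0 - 2 * (a \<bullet> z)"
        using z by (simp add: D_def D0_def power2_norm_eq_inner inner_diff_left inner_diff_right
            inner_commute[of z a] norm_eq_1)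
      ultimately show "\<beta> *\<^sub>R p = (D0 *\<^sub>R v - b *\<^sub>R U a) + (b *\<^sub>R U z - (2 * (a \<bullet> z)) *\<^sub>R v)"
        by (simp add: algebra_simps)
    qed
  qed
qed

section \<open>Equality of the averages\<close>

lemma design_average_of_affine_image:
  fixes F :: "real^'n::finite \<Rightarrow> real"
  assumes "spherical_design M n xbar" and "polynomial_of_degree_le M F" and "linear L"
    and "\<And>i. i < n \<Longrightarrow> w i = e + L (xbar i)"
  shows "(1 / real n) * (\<Sum>i<n. F (w i)) = (\<integral>z. F (e + L z) \<partial>sphere_measure)"
proof -
  have "(\<integral>z. F (e + L z) \<partial>sphere_measure) = (1 / real n) * (\<Sum>i<n. F (e + L (xbar i)))"
    using assms(1) polynomial_of_degree_le_affine[OF assms(2,3)]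
    unfolding spherical_design_def by blast
  also have "(\<Sum>i<n. F (e + L (xbar i))) = (\<Sum>i<n. F (w i))"
    using assms(4) by (intro sum.cong) simp_all
  finally show ?thesis ..
qed

theorem theorem4:
  fixes d M n q :: nat
    and xbar ybar x y :: "nat \<Rightarrow> real^'n"
    and b c :: "nat \<Rightarrow> real"
    and bbar :: real
    and \<Psi> :: "(real^'n) option \<Rightarrow> (real^'n) option"
    and F :: "real^'n \<Rightarrow> real"
  assumes "d \<ge> 1" and "CARD('n) = d + 1"
    and "spherical_design M n xbar"
    and "spherical_design M q ybar"
    and "bbar > 0"
    and "conformal_transformation \<Psi>"
    and "\<And>i. i < n \<Longrightarrow> b i \<noteq> 0 \<and>
           transport \<Psi> (cooriented_sphere (xbar i) bbar) = cooriented_sphere (x i) (b i)"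
    and "\<And>j. j < q \<Longrightarrow> c j \<noteq> 0 \<and>
           transport \<Psi> (cooriented_sphere (ybar j) bbar) = cooriented_sphere (y j) (c j)"
    and "polynomial_of_degree_le M F"
  shows "(1 / real n) * (\<Sum>i<n. F (b i *\<^sub>R x i)) = (1 / real q) * (\<Sum>j<q. F (c j *\<^sub>R y j))"
proof -
  have "bbar \<noteq> 0"
    using assms(5) by simp
  then obtain L e where L: "linear L" and affine: "\<forall>z p \<beta>. norm z = 1 \<longrightarrow> \<beta> \<noteq> 0 \<longrightarrow>
      transport \<Psi> (cooriented_sphere z bbar) = cooriented_sphere p \<beta> \<longrightarrow> \<beta> *\<^sub>R p = e + L z"
    by (rule curvature_times_centre_affine[OF assms(6)])
  have unit: "norm (z i) = 1" if "spherical_design M m z" "i < m"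
    for m i and z :: "nat \<Rightarrow> real^'n"
    using that by (auto simp: spherical_design_def)
  have "b i *\<^sub>R x i = e + L (xbar i)" if "i < n" for i
    by (rule affine[rule_format, OF unit[OF assms(3) that]]) (use assms(7)[OF that] in blast)+
  then have "(1 / real n) * (\<Sum>i<n. F (b i *\<^sub>R x i)) = (\<integral>z. F (e + L z) \<partial>sphere_measure)"
    by (rule design_average_of_affine_image[OF assms(3,9) L])
  moreover have "c j *\<^sub>R y j = e + L (ybar j)" if "j < q" for j
    by (rule affine[rule_format, OF unit[OF assms(4) that]]) (use assms(8)[OF that] in blast)+
  then have "(1 / real q) * (\<Sum>j<q. F (c j *\<^sub>R y j)) = (\<integral>z. F (e + L z) \<partial>sphere_measure)"
    by (rule design_average_of_affine_image[OF assms(4,9) L])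
  ultimately show ?thesis by simp
qed

end
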